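(* Let $I\subseteq\mathbb{R}$ be a non-empty open interval and let $t\in(0,1)$ be fixed. If $f:I\to\mathbb{R}$ is non-symmetrically $t$-affine, then $f$ is locally $t$-affine.
   Context: Intervals are not required to be bounded. A function $f:I\to\mathbb{R}$ is called non-symmetrically $t$-affine if $f(tx+(1-t)y)=tf(x)+(1-t)f(y)$ for all $x,y\in I$ with $x\leq y$. A function $g:J\to\mathbb{R}$ on an interval $J$ is called $t$-convex (on $J$) if $g(tx+(1-t)y)\leq tg(x)+(1-t)g(y)$ for all $x,y\in J$ (no order restriction on $x,y$). A function $f:I\to\mathbb{R}$ is locally $t$-convex on $I$ if for every point $p\in I$ there exists an open interval $U\subseteq\mathbb{R}$ with $p\in U$ such that $f$ is $t$-convex on $U\cap I$. A function $f$ is locally $t$-affine if both $f$ and $-f$ are locally $t$-convex on $I$. *)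

theory Defs
  imports "HOL-Analysis.Analysis"
begin

(* A function I -> R is a total function real => real of which only the values on I matter.
   On an interval I with 0 < t < 1, the point t x + (1 - t) y lies in I for all x, y in I, so no
   definition below looks at a value outside its set. Intervals are given by is_interval, which
   allows unbounded ones. *)

definition nonsym_t_affine_on :: "real \<Rightarrow> real set \<Rightarrow> (real \<Rightarrow> real) \<Rightarrow> bool" where
  "nonsym_t_affine_on t I f \<longleftrightarrow>
     (\<forall>x\<in>I. \<forall>y\<in>I. x \<le> y \<longrightarrow> f (t * x + (1 - t) * y) = t * f x + (1 - t) * f y)"

definition t_convex_on :: "real \<Rightarrow> real set \<Rightarrow> (real \<Rightarrow> real) \<Rightarrow> bool" where
  "t_convex_on t J g \<longleftrightarrow>
     (\<forall>x\<in>J. \<forall>y\<in>J. g (t * x + (1 - t) * y) \<le> t * g x + (1 - t) * g y)"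

definition locally_t_convex_on :: "real \<Rightarrow> real set \<Rightarrow> (real \<Rightarrow> real) \<Rightarrow> bool" where
  "locally_t_convex_on t I f \<longleftrightarrow>
     (\<forall>p\<in>I. \<exists>U. open U \<and> is_interval U \<and> p \<in> U \<and> t_convex_on t (U \<inter> I) f)"

definition locally_t_affine_on :: "real \<Rightarrow> real set \<Rightarrow> (real \<Rightarrow> real) \<Rightarrow> bool" where
  "locally_t_affine_on t I f \<longleftrightarrow>
     locally_t_convex_on t I f \<and> locally_t_convex_on t I (\<lambda>x. - f x)"

end

theory Submission
  imports Defs
begin

text \<open>
  Fix \<open>p\<close> in \<open>I\<close>. The point \<open>p\<close> is the mean \<open>t * x0 + (1 - t) * y0\<close> of two points
  \<open>x0 < p < y0\<close> of \<open>I\<close>. Small independent perturbations of \<open>x0\<close> and \<open>y0\<close> keep their order, so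
  the hypothesis remains usable and becomes a Pexider equation: near \<open>p\<close>, \<open>f\<close> is a sum of a function
  of the perturbation of \<open>x0\<close> and a function of the perturbation of \<open>y0\<close>
  (\<open>nonsym_t_affine_split\<close>). Two consequences follow.

  First, the increments \<open>f (p + h) - f p\<close> are additive in \<open>h\<close> for small \<open>h\<close>
  (\<open>nonsym_t_affine_locally_additive\<close>).

  Second, moving only \<open>x0\<close> shows that the increment of \<open>f\<close> at \<open>p\<close> by \<open>t * h\<close> is \<open>t\<close> times the
  increment at \<open>x0\<close> by \<open>h\<close>. Once \<open>x0\<close> is chosen inside the neighbourhood of \<open>p\<close> on which increments
  are additive, the increment by \<open>h\<close> is the same at \<open>x0\<close> as at \<open>p\<close>, so increments at \<open>p\<close> are
  homogeneous with respect to \<open>t\<close> (\<open>nonsym_t_affine_locally_homogeneous\<close>).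

  Additivity and homogeneity of the increments at \<open>p\<close> give the affine equation for all pairs
  of points near \<open>p\<close>, in either order.
\<close>

text \<open>
  The base points \<open>p - (1 - t) * d\<close> and \<open>p + t * d\<close> have mean \<open>p\<close> and lie exactly \<open>d\<close> apart,
  so total displacement at most \<open>d\<close> cannot reverse their order.
\<close>

lemma nonsym_t_affine_split:
  fixes t d p h k :: real
  assumes t: "0 < t" "t < 1" and aff: "nonsym_t_affine_on t I f"
    and d: "0 < d" and sub: "{p - 2 * d<..<p + 2 * d} \<subseteq> I"
    and hk: "\<bar>h\<bar> + \<bar>k\<bar> \<le> d"
  shows "f (p + t * h + (1 - t) * k) = t * f (p - (1 - t) * d + h) + (1 - t) * f (p + t * d + k)"
proof -
  let ?x = "p - (1 - t) * d + h" and ?y = "p + t * d + k"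
  have "0 < t * d" and "t * d < d" and "(1 - t) * d = d - t * d"
    using t d by (simp_all add: left_diff_distrib)
  then have "?x \<in> {p - 2 * d<..<p + 2 * d}" and "?y \<in> {p - 2 * d<..<p + 2 * d}" and "?x \<le> ?y"
    using hk d unfolding greaterThanLessThan_iff by linarith+
  then have "f (t * ?x + (1 - t) * ?y) = t * f ?x + (1 - t) * f ?y"
    using aff sub unfolding nonsym_t_affine_on_def by blast
  moreover have "t * ?x + (1 - t) * ?y = p + t * h + (1 - t) * k"
    by (simp add: algebra_simps)
  ultimately show ?thesis
    by simp
qed

lemma open_contains_symmetric_interval:
  fixes p :: real
  assumes "open I" and "p \<in> I"
  obtains d where "0 < d" and "{p - 2 * d<..<p + 2 * d} \<subseteq> I"
proof -
  obtain e where e: "0 < e" "ball p e \<subseteq> I"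
    using assms by (auto simp: open_contains_ball)
  have "{p - 2 * (e / 2)<..<p + 2 * (e / 2)} \<subseteq> I"
    using e by (simp add: ball_eq_greaterThanLessThan)
  then show thesis
    using that[of "e / 2"] e by simp
qed

text \<open>
  In the mixed difference over the two displacements, the two summands of the splitting cancel
  separately.
\<close>

lemma nonsym_t_affine_locally_additive:
  fixes t p :: real
  assumes t: "0 < t" "t < 1" and aff: "nonsym_t_affine_on t I f"
    and I: "open I" "p \<in> I"
  obtains r where "0 < r"
    and "\<And>u v. \<bar>u\<bar> < r \<Longrightarrow> \<bar>v\<bar> < r \<Longrightarrow> f (p + u + v) - f (p + u) = f (p + v) - f p"
proof -
  obtain d where d: "0 < d" "{p - 2 * d<..<p + 2 * d} \<subseteq> I"
    using open_contains_symmetric_interval[OF I] .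
  note split = nonsym_t_affine_split[OF t aff d]
  \<comment> \<open>Displacements \<open>u\<close> and \<open>v\<close> of the mean require displacements \<open>u / t\<close> and \<open>v / (1 - t)\<close> of the
      base points, each of which may use up half of the admissible total \<open>d\<close>.\<close>
  define r where "r = min t (1 - t) * (d / 2)"
  have "0 < r"
    using t d by (simp add: r_def)
  moreover have "f (p + u + v) - f (p + u) = f (p + v) - f p" if u: "\<bar>u\<bar> < r" and v: "\<bar>v\<bar> < r" for u v
  proof -
    define h k where "h = u / t" and "k = v / (1 - t)"
    have th: "t * h = u" and sk: "(1 - t) * k = v"
      using t by (simp_all add: h_def k_def)
    have "r \<le> t * (d / 2)" and "r \<le> (1 - t) * (d / 2)"
      unfolding r_def using d by (intro mult_right_mono; simp)+
    then have "\<bar>u\<bar> \<le> t * (d / 2)" and "\<bar>v\<bar> \<le> (1 - t) * (d / 2)"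
      using u v by linarith+
    then have h: "\<bar>h\<bar> \<le> d / 2" and k: "\<bar>k\<bar> \<le> d / 2"
      using t by (simp_all add: h_def k_def divide_le_eq mult.commute)
    show ?thesis
      using split[of h k] split[of h 0] split[of 0 k] split[of 0 0] h k d th sk by simp
  qed
  ultimately show thesis
    using that by blast
qed

lemma nonsym_t_affine_locally_homogeneous:
  fixes t p :: real
  assumes t: "0 < t" "t < 1" and aff: "nonsym_t_affine_on t I f"
    and I: "open I" "p \<in> I"
  obtains r where "0 < r"
    and "\<And>h. \<bar>h\<bar> < r \<Longrightarrow> f (p + t * h) - f p = t * (f (p + h) - f p)"
proof -
  obtain r where r: "0 < r"
    and add: "\<And>u v. \<bar>u\<bar> < r \<Longrightarrow> \<bar>v\<bar> < r \<Longrightarrow> f (p + u + v) - f (p + u) = f (p + v) - f p"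
    using nonsym_t_affine_locally_additive[OF t aff I] by blast
  obtain d0 where d0: "0 < d0" "{p - 2 * d0<..<p + 2 * d0} \<subseteq> I"
    using open_contains_symmetric_interval[OF I] .
  \<comment> \<open>Spacing at most \<open>r\<close> puts the left base point inside the range of additivity.\<close>
  define d where "d = min d0 r"
  have d: "0 < d" "{p - 2 * d<..<p + 2 * d} \<subseteq> I" "d \<le> r"
    using d0 r by (auto simp: d_def intro!: subsetD[OF d0(2)])
  note split = nonsym_t_affine_split[OF t aff d(1,2)]
  have "f (p + t * h) - f p = t * (f (p + h) - f p)" if h: "\<bar>h\<bar> < d" for h
  proof -
    have "0 < (1 - t) * d" and "(1 - t) * d < d"
      using t d by simp_all
    then have "\<bar>- ((1 - t) * d)\<bar> < r"
      using d by linarith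
    then have incr: "f (p - (1 - t) * d + h) - f (p - (1 - t) * d) = f (p + h) - f p"
      using add[of "- ((1 - t) * d)" h] h d by simp
    have "f (p + t * h) - f p = t * (f (p - (1 - t) * d + h) - f (p - (1 - t) * d))"
      using split[of h 0] split[of 0 0] h d by (simp add: right_diff_distrib)
    then show ?thesis
      using incr by simp
  qed
  then show thesis
    using that d(1) by blast
qed

text \<open>
  Homogeneity with respect to \<open>1 - t\<close> comes from homogeneity with respect to \<open>t\<close>, since by
  additivity the increment by \<open>k\<close> is the sum of the increments by \<open>t * k\<close> and \<open>(1 - t) * k\<close>.
\<close>

lemma nonsym_t_affine_imp_t_affine_near:
  fixes t p :: real
  assumes t: "0 < t" "t < 1" and aff: "nonsym_t_affine_on t I f"
    and I: "open I" "p \<in> I"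
  obtains r where "0 < r"
    and "\<And>x y. x \<in> {p - r<..<p + r} \<Longrightarrow> y \<in> {p - r<..<p + r} \<Longrightarrow>
           f (t * x + (1 - t) * y) = t * f x + (1 - t) * f y"
proof -
  obtain r1 where r1: "0 < r1"
    and add: "\<And>u v. \<bar>u\<bar> < r1 \<Longrightarrow> \<bar>v\<bar> < r1 \<Longrightarrow> f (p + u + v) - f (p + u) = f (p + v) - f p"
    using nonsym_t_affine_locally_additive[OF t aff I] by blast
  obtain r2 where r2: "0 < r2"
    and hom: "\<And>h. \<bar>h\<bar> < r2 \<Longrightarrow> f (p + t * h) - f p = t * (f (p + h) - f p)"
    using nonsym_t_affine_locally_homogeneous[OF t aff I] by blast
  have "f (t * x + (1 - t) * y) = t * f x + (1 - t) * f y"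
    if x: "x \<in> {p - min r1 r2<..<p + min r1 r2}" and y: "y \<in> {p - min r1 r2<..<p + min r1 r2}" for x y
  proof -
    define h k where "h = x - p" and "k = y - p"
    have h: "\<bar>h\<bar> < r1" "\<bar>h\<bar> < r2" and k: "\<bar>k\<bar> < r1" "\<bar>k\<bar> < r2"
      using x y by (auto simp: h_def k_def)
    have "\<bar>t * h\<bar> \<le> \<bar>h\<bar>" and "\<bar>t * k\<bar> \<le> \<bar>k\<bar>" and "\<bar>(1 - t) * k\<bar> \<le> \<bar>k\<bar>"
      using t by (simp_all add: abs_mult mult_left_le_one_le)
    then have small: "\<bar>t * h\<bar> < r1" "\<bar>t * k\<bar> < r1" "\<bar>(1 - t) * k\<bar> < r1"
      using h k by linarith+
    have "p + t * k + (1 - t) * k = p + k"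
      by (simp add: algebra_simps)
    then have "f (p + (1 - t) * k) - f p = f (p + k) - f (p + t * k)"
      using add[OF small(2,3)] by metis
    also have "\<dots> = (1 - t) * (f (p + k) - f p)"
      using hom[OF k(2)] by (simp add: algebra_simps)
    finally have hom': "f (p + (1 - t) * k) - f p = (1 - t) * (f (p + k) - f p)" .
    have "f (p + t * h + (1 - t) * k) = t * f (p + h) + (1 - t) * f (p + k)"
      using add[OF small(1,3)] hom[OF h(2)] hom' by (simp add: algebra_simps)
    moreover have "p + t * h + (1 - t) * k = t * x + (1 - t) * y"
      by (simp add: h_def k_def algebra_simps)
    ultimately show ?thesis
      by (simp add: h_def k_def)
  qed
  then show thesis
    using that[of "min r1 r2"] r1 r2 by simp
qed

theorem theorem1:
  fixes I :: "real set" and t :: real and f :: "real \<Rightarrow> real"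
  assumes "open I" and "is_interval I" and "I \<noteq> {}"
    and "0 < t" and "t < 1"
    and "nonsym_t_affine_on t I f"
  shows "locally_t_affine_on t I f"
proof -
  have "\<exists>U. open U \<and> is_interval U \<and> p \<in> U \<and>
      t_convex_on t (U \<inter> I) f \<and> t_convex_on t (U \<inter> I) (\<lambda>x. - f x)" if "p \<in> I" for p
  proof -
    obtain r where r: "0 < r"
      and eq: "\<And>x y. x \<in> {p - r<..<p + r} \<Longrightarrow> y \<in> {p - r<..<p + r} \<Longrightarrow>
                 f (t * x + (1 - t) * y) = t * f x + (1 - t) * f y"
      using nonsym_t_affine_imp_t_affine_near[OF assms(4,5,6,1) \<open>p \<in> I\<close>] by blast
    have "t_convex_on t ({p - r<..<p + r} \<inter> I) f"
      and "t_convex_on t ({p - r<..<p + r} \<inter> I) (\<lambda>x. - f x)"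
      unfolding t_convex_on_def by (simp_all add: eq)
    moreover have "is_interval {p - r<..<p + r}"
      by (simp add: is_interval_convex_1)
    ultimately show ?thesis
      using r by (intro exI[of _ "{p - r<..<p + r}"]) simp
  qed
  then show ?thesis
    unfolding locally_t_affine_on_def locally_t_convex_on_def by blast
qed

end
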